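(* Let $\Gamma$ be a smooth closed convex plane bicycle curve. If the rotation number of $\Gamma$ equals $1/4$, then $\Gamma$ is a circle.
   Context: A closed smooth convex plane curve $\Gamma$ of perimeter length $2\pi$ (the normalization used throughout), parameterized by arc length as $\Gamma:\mathbf{R}/2\pi\mathbf{Z}\to\mathbf{R}^2$, is a bicycle curve with rotation number $\rho\in(0,1)$ if the distance $|\Gamma(x+2\pi\rho)-\Gamma(x)|$ does not depend on $x$. *)

theory Defs
  imports "HOL-Analysis.Analysis"
begin

text \<open>
  A curve on the circle of length \<open>2 * pi\<close> is represented by a \<open>2 * pi\<close>-periodic map
  defined on all of the real line.
\<close>

definition smooth_curve :: "(real \<Rightarrow> real^2) \<Rightarrow> bool" where
  "smooth_curve \<Gamma> \<longleftrightarrow>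
     (\<forall>n t. ((\<lambda>f s. vector_derivative f (at s)) ^^ n) \<Gamma> differentiable (at t))"

text \<open>
  Unit speed together with injectivity on a period forces the perimeter to be \<open>2 * pi\<close>.
  Convexity is in the weak sense (line segments on the curve are not excluded):
  the curve is the boundary of a convex body.
\<close>

definition smooth_closed_convex_curve :: "(real \<Rightarrow> real^2) \<Rightarrow> bool" where
  "smooth_closed_convex_curve \<Gamma> \<longleftrightarrow>
     smooth_curve \<Gamma> \<and>
     (\<forall>x. \<Gamma> (x + 2 * pi) = \<Gamma> x) \<and>
     inj_on \<Gamma> {0..<2 * pi} \<and>
     (\<forall>x. norm (vector_derivative \<Gamma> (at x)) = 1) \<and>
     (\<exists>K. compact K \<and> convex K \<and> interior K \<noteq> {} \<and> frontier K = range \<Gamma>)"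

definition bicycle_curve :: "(real \<Rightarrow> real^2) \<Rightarrow> real \<Rightarrow> bool" where
  "bicycle_curve \<Gamma> \<rho> \<longleftrightarrow>
     smooth_closed_convex_curve \<Gamma> \<and> 0 < \<rho> \<and> \<rho> < 1 \<and>
     (\<exists>l. \<forall>x. norm (\<Gamma> (x + 2 * pi * \<rho>) - \<Gamma> x) = l)"

definition is_circle :: "(real^2) set \<Rightarrow> bool" where
  "is_circle S \<longleftrightarrow> (\<exists>c r. 0 < r \<and> S = sphere c r)"

end

theory Submission imports Defs begin

text \<open>
  The points \<open>A, B, C, D\<close> of parameters \<open>t, t + \<pi>/2, t + \<pi>, t + 3\<pi>/2\<close> form a rhombus,
  so \<open>A + C = B + D\<close>; differentiating, the unit velocities satisfy \<open>A' + C' = B' + D'\<close>.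
  A nonzero common value would force \<open>B' = A'\<close> or \<open>B' = C'\<close>.
  But if two points of parameter distance \<open>\<pi>/2\<close> had the same velocity, they would lie on a
  common support line, so a piece of the curve would be straight and the chord would have
  length \<open>\<pi>/2\<close>; this is then true of all chords, and the curve would be a line.
  Hence the centre \<open>m\<close> of the rhombus is constant. With \<open>p = A - m\<close> and \<open>q = B - m\<close>,
  differentiating \<open>p \<bullet> q = 0\<close> and \<open>\<bar>p\<bar>\<^sup>2 + \<bar>q\<bar>\<^sup>2 = const\<close> shows that \<open>p + q\<close> and \<open>p - q\<close>
  are orthogonal to \<open>p' + q'\<close> and \<open>p' - q'\<close>, which are nonzero and orthogonal to each other.
  So \<open>p + q\<close> and \<open>p - q\<close> are orthogonal, and \<open>\<bar>p\<bar> = \<bar>q\<bar>\<close> is constant.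
\<close>

section \<open>Plane geometry\<close>

definition cross2 :: "real^2 \<Rightarrow> real^2 \<Rightarrow> real" where
  "cross2 u v = u $ 1 * v $ 2 - u $ 2 * v $ 1"

lemma cross2_diff_right: "cross2 u (v - w) = cross2 u v - cross2 u w"
  by (simp add: cross2_def algebra_simps)

lemma cross2_scaleR_right: "cross2 u (c *\<^sub>R v) = c * cross2 u v"
  by (simp add: cross2_def algebra_simps)

text \<open>Parseval's identity in the orthogonal frame formed by \<open>u\<close> and
  \<open>u\<close> turned through a right angle, scaled by \<open>u \<bullet> u\<close>.\<close>

lemma inner_cross2_identity:
  "(u \<bullet> v) * (u \<bullet> w) + cross2 u v * cross2 u w = (u \<bullet> u) * (v \<bullet> w)"
  by (simp add: cross2_def inner_vec_def sum_2 algebra_simps)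

lemma eq_zero_if_inner_cross2:
  assumes "u \<noteq> 0" "u \<bullet> v = 0" "cross2 u v = 0"
  shows "v = 0"
  using inner_cross2_identity[of u v v] assms by simp

text \<open>In the plane \<open>v\<close> spans the orthogonal complement of \<open>u\<close>, so
  \<open>y\<close>, being orthogonal to \<open>v\<close>, is a multiple of \<open>u\<close>.\<close>

lemma orthogonal_if_orthogonal_to_orthogonal:
  fixes u v w y :: "real^2"
  assumes "u \<noteq> 0" "v \<noteq> 0" "u \<bullet> v = 0" "u \<bullet> w = 0" "v \<bullet> y = 0"
  shows "w \<bullet> y = 0"
proof -
  have "cross2 u v \<noteq> 0"
    using eq_zero_if_inner_cross2 assms by blast
  moreover have "cross2 u v * cross2 u y = 0"
    using inner_cross2_identity[of u v y] assms by simp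
  ultimately have "cross2 u y = 0" by simp
  then show ?thesis
    using inner_cross2_identity[of u w y] assms by simp
qed

text \<open>\<open>B\<close> and \<open>D\<close> lie on the perpendicular bisector of
  \<open>A\<close> and \<open>C\<close>, equally far from the line through these; being distinct,
  they are mirror images in that line.\<close>

lemma rhombus_diagonals_bisect:
  fixes A B C D :: "real^2"
  assumes "norm (B - A) = l" "norm (C - B) = l" "norm (D - C) = l" "norm (A - D) = l"
    and "A \<noteq> C" "B \<noteq> D"
  shows "A + C = B + D"
proof -
  define u P Q where "u = C - A" and "P = B - A" and "Q = D - A"
  have u: "u \<noteq> 0" and PQ: "P - Q \<noteq> 0"
    using assms by (auto simp: u_def P_def Q_def)
  have n: "P \<bullet> P = l^2" "Q \<bullet> Q = l^2" "(u - P) \<bullet> (u - P) = l^2" "(Q - u) \<bullet> (Q - u) = l^2"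
    using assms by (simp_all add: u_def P_def Q_def norm_minus_commute flip: power2_norm_eq_inner)
  have uP: "2 * (u \<bullet> P) = u \<bullet> u" and uQ: "2 * (u \<bullet> Q) = u \<bullet> u"
    using n by (simp_all add: inner_diff_left inner_diff_right inner_commute)
  \<comment> \<open>\<open>cross2 u\<close> is, up to the factor \<open>norm u\<close>, the signed
    distance from the line through \<open>A\<close> and \<open>C\<close>.\<close>
  have "cross2 u P * cross2 u P = cross2 u Q * cross2 u Q"
    using inner_cross2_identity[of u P P] inner_cross2_identity[of u Q Q] n uP uQ
    by (smt (verit) mult_cancel_left)
  moreover have "cross2 u P \<noteq> cross2 u Q"
    using eq_zero_if_inner_cross2[OF u, of "P - Q"] PQ uP uQ
    by (auto simp: cross2_diff_right inner_diff_right)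
  ultimately have "cross2 u P = - cross2 u Q"
    by (simp add: square_eq_iff)
  then have "cross2 u (P + Q - u) = 0"
    by (simp add: cross2_def algebra_simps)
  moreover have "u \<bullet> (P + Q - u) = 0"
    using uP uQ by (simp add: inner_diff_right inner_add_right)
  ultimately have "P + Q - u = 0"
    using eq_zero_if_inner_cross2[OF u] by blast
  then show ?thesis
    by (simp add: u_def P_def Q_def algebra_simps)
qed

text \<open>The equality case of the triangle inequality, by the parallelogram law.\<close>

lemma eq_midpoint_if_dist_le:
  fixes A B M :: "'a::real_inner"
  assumes "norm (M - A) \<le> r" "norm (B - M) \<le> r" "norm (B - A) = 2 * r"
  shows "M - A = B - M"
proof -
  have r: "norm (M - A) ^ 2 \<le> r ^ 2" "norm (B - M) ^ 2 \<le> r ^ 2"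
    using assms by (simp_all add: power_mono)
  have "norm ((M - A) - (B - M)) ^ 2 + norm (B - A) ^ 2
      = 2 * norm (M - A) ^ 2 + 2 * norm (B - M) ^ 2"
    by (simp add: power2_norm_eq_inner inner_diff_left inner_diff_right inner_commute algebra_simps)
  moreover have "norm (B - A) ^ 2 = 4 * r ^ 2"
    using assms(3) by (simp add: power_mult_distrib)
  ultimately have "norm ((M - A) - (B - M)) ^ 2 \<le> 0"
    using r by linarith
  then show ?thesis by simp
qed

text \<open>Every ray from \<open>m\<close> meets the frontier of a bounded set, and the ray through
  a point of the sphere meets the sphere nowhere else.\<close>

lemma frontier_eq_sphere_if_subset:
  fixes K :: "'a::euclidean_space set"
  assumes "bounded K" "m \<in> interior K" "frontier K \<subseteq> sphere m r" "0 < r"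
  shows "frontier K = sphere m r"
proof
  show "sphere m r \<subseteq> frontier K"
  proof
    fix y assume y: "y \<in> sphere m r"
    then have "y - m \<noteq> 0" using assms(4) by auto
    then obtain d where d: "0 < d" "m + d *\<^sub>R (y - m) \<in> frontier K"
      using ray_to_frontier[OF assms(1,2)] by blast
    then have "dist m (m + d *\<^sub>R (y - m)) = r"
      using assms(3) by auto
    moreover have "norm (y - m) = r"
      using y by (simp add: dist_norm norm_minus_commute)
    ultimately have "d * r = r"
      using d by (simp add: dist_norm)
    then have "d = 1" using assms(4) by simp
    then show "y \<in> frontier K" using d by simp
  qed
qed (use assms in simp)

section \<open>Convex curves\<close>

locale convex_curve =
  fixes \<Gamma> :: "real \<Rightarrow> real^2"
  assumes curve: "smooth_closed_convex_curve \<Gamma>"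
begin

section \<open>Velocity, periodicity and injectivity\<close>

definition vel :: "real \<Rightarrow> real^2" where
  "vel t = vector_derivative \<Gamma> (at t)"

lemma has_vel: "(\<Gamma> has_vector_derivative vel t) (at t within S)"
proof -
  have "\<Gamma> differentiable (at t)"
    using curve unfolding smooth_closed_convex_curve_def smooth_curve_def
    by (metis funpow_0)
  then show ?thesis
    unfolding vel_def
    using vector_derivative_works has_vector_derivative_at_within by blast
qed

lemma continuous_curve: "continuous_on S \<Gamma>"
  using has_vel by (meson continuous_on_eq_continuous_within has_vector_derivative_continuous)

lemma continuous_vel: "continuous_on S vel"
proof -
  have "((\<lambda>f s. vector_derivative f (at s)) ^^ 1) \<Gamma> differentiable (at t)" for t
    using curve unfolding smooth_closed_convex_curve_def smooth_curve_def by blast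
  then have "vel differentiable (at t)" for t
    by (simp add: vel_def[abs_def])
  then show ?thesis
    by (meson continuous_at_imp_continuous_on differentiable_imp_continuous_within)
qed

lemma norm_vel: "norm (vel t) = 1"
  using curve by (simp add: smooth_closed_convex_curve_def vel_def)

lemma vel_nonzero: "vel t \<noteq> 0"
  using norm_vel[of t] by auto

lemma lipschitz: "norm (\<Gamma> t - \<Gamma> s) \<le> \<bar>t - s\<bar>"
proof -
  have "norm (\<Gamma> t - \<Gamma> s) \<le> 1 * norm (t - s)"
  proof (rule differentiable_bound[of UNIV \<Gamma> "\<lambda>t h. h *\<^sub>R vel t"])
    show "onorm (\<lambda>h. h *\<^sub>R vel x) \<le> 1" for x
      by (rule onorm_le) (simp add: norm_vel)
  qed (use has_vel in \<open>auto simp: has_vector_derivative_def\<close>)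
  then show ?thesis by simp
qed

sublocale periodic_fun_simple \<Gamma> "2 * pi"
  using curve by unfold_locales (simp add: smooth_closed_convex_curve_def)

lemma has_vel_shift: "((\<lambda>t. \<Gamma> (t + c)) has_vector_derivative vel (t + c)) (at t)"
proof -
  have "((\<lambda>s. s + c) has_vector_derivative 1) (at t)"
    by (auto intro!: derivative_eq_intros)
  from vector_diff_chain_at[OF this has_vel] show ?thesis
    by (simp add: o_def)
qed

lemma curve_neq:
  assumes "s < t" "t < s + 2 * pi"
  shows "\<Gamma> s \<noteq> \<Gamma> t"
proof
  assume eq: "\<Gamma> s = \<Gamma> t"
  \<comment> \<open>The numbers of whole periods to remove so that \<open>s\<close> and
    \<open>t\<close> fall into the interval of injectivity; \<open>t - s\<close> then becomes an
    integer multiple of the period lying strictly between zero and one period.\<close>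
  define m n where "m = \<lfloor>s / (2 * pi)\<rfloor>" and "n = \<lfloor>t / (2 * pi)\<rfloor>"
  have "of_int m \<le> s / (2 * pi)" "s / (2 * pi) < of_int m + 1"
    "of_int n \<le> t / (2 * pi)" "t / (2 * pi) < of_int n + 1"
    by (simp_all add: m_def n_def floor_correct)
  then have m: "of_int m * (2 * pi) \<le> s" "s < (of_int m + 1) * (2 * pi)"
    and n: "of_int n * (2 * pi) \<le> t" "t < (of_int n + 1) * (2 * pi)"
    by (simp_all only: pos_le_divide_eq pos_divide_less_eq pi_gt_zero mult_pos_pos zero_less_numeral)
  have "inj_on \<Gamma> {0..<2 * pi}"
    using curve by (simp add: smooth_closed_convex_curve_def)
  moreover have "\<Gamma> (s - of_int m * (2 * pi)) = \<Gamma> (t - of_int n * (2 * pi))"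
    using eq by (simp add: minus_of_int)
  ultimately have "s - of_int m * (2 * pi) = t - of_int n * (2 * pi)"
    by (rule inj_onD) (use m n in \<open>auto simp: algebra_simps\<close>)
  then have k: "t - s = of_int (n - m) * (2 * pi)"
    by (simp add: algebra_simps)
  then have "0 < of_int (n - m) * (2 * pi)" "of_int (n - m) * (2 * pi) < 1 * (2 * pi)"
    using assms by linarith+
  then have "0 < real_of_int (n - m)" "real_of_int (n - m) < 1"
    by (simp_all add: zero_less_mult_iff del: of_int_diff)
  then show False by (simp only: of_int_0_less_iff of_int_less_1_iff)
qed

section \<open>Support lines and orientation\<close>

definition body :: "(real^2) set" where
  "body = (SOME K. compact K \<and> convex K \<and> interior K \<noteq> {} \<and> frontier K = range \<Gamma>)"

lemma body: "compact body" "convex body" "interior body \<noteq> {}" "frontier body = range \<Gamma>"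
proof -
  have "\<exists>K. compact K \<and> convex K \<and> interior K \<noteq> {} \<and> frontier K = range \<Gamma>"
    using curve by (simp add: smooth_closed_convex_curve_def)
  then have "compact body \<and> convex body \<and> interior body \<noteq> {} \<and> frontier body = range \<Gamma>"
    unfolding body_def by (rule someI_ex)
  then show "compact body" "convex body" "interior body \<noteq> {}" "frontier body = range \<Gamma>"
    by blast+
qed

lemma curve_in_body: "\<Gamma> t \<in> body"
  using body(1,4) compact_imp_closed frontier_subset_closed by blast

lemma inner_vel_eq_0_at_min:
  assumes "\<And>s. a \<bullet> \<Gamma> t \<le> a \<bullet> \<Gamma> s"
  shows "a \<bullet> vel t = 0"
proof (rule DERIV_local_min)
  show "((\<lambda>s. a \<bullet> \<Gamma> s) has_real_derivative a \<bullet> vel t) (at t)"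
    using bounded_linear.has_vector_derivative[OF bounded_linear_inner_right has_vel]
    by (simp add: has_real_derivative_iff_has_vector_derivative)
qed (use assms in \<open>auto intro: zero_less_one\<close>)

text \<open>A supporting functional at \<open>\<Gamma> t\<close> is minimal there along the curve,
  so it annihilates \<open>vel t\<close>; in the plane it is then a multiple of
  \<open>cross2 (vel t)\<close>.\<close>

lemma support_line:
  obtains k where "\<And>y. y \<in> body \<Longrightarrow> 0 \<le> k * cross2 (vel t) (y - \<Gamma> t)"
    and "\<And>y. y \<in> interior body \<Longrightarrow> 0 < k * cross2 (vel t) (y - \<Gamma> t)"
proof -
  have ri: "rel_interior body = interior body"
    using body(3) by (rule rel_interior_nonempty_interior)
  have "\<Gamma> t \<notin> interior body"
    using body(4) unfolding frontier_def by blast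
  then obtain a where a: "\<And>y. y \<in> body \<Longrightarrow> a \<bullet> \<Gamma> t \<le> a \<bullet> y"
    "\<And>y. y \<in> interior body \<Longrightarrow> a \<bullet> \<Gamma> t < a \<bullet> y"
    using supporting_hyperplane_rel_boundary[OF body(2) curve_in_body, of t] ri by metis
  have "a \<bullet> vel t = 0"
    using a(1) curve_in_body by (intro inner_vel_eq_0_at_min) blast
  moreover have "vel t \<bullet> vel t = 1"
    using norm_vel[of t] by (simp add: norm_eq_1)
  ultimately have "cross2 (vel t) a * cross2 (vel t) v = a \<bullet> v" for v
    using inner_cross2_identity[of "vel t" a v] by (simp add: inner_commute)
  then show ?thesis
    using a by (intro that[of "cross2 (vel t) a"]) (simp_all add: inner_diff_right)
qed

text \<open>The factor in \<open>support_line\<close> depends on \<open>t\<close>, but its sign does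
  not: for a fixed interior point \<open>z\<close>, the continuous function \<open>h\<close> never
  vanishes.\<close>

lemma orientation:
  obtains \<sigma> where "\<And>t y. y \<in> body \<Longrightarrow> 0 \<le> \<sigma> * cross2 (vel t) (y - \<Gamma> t)"
    and "\<And>t y. y \<in> interior body \<Longrightarrow> 0 < \<sigma> * cross2 (vel t) (y - \<Gamma> t)"
proof -
  obtain z where z: "z \<in> interior body" using body(3) by blast
  define h where "h t = cross2 (vel t) (z - \<Gamma> t)" for t
  have cont: "continuous_on S h" for S
    unfolding h_def cross2_def by (intro continuous_intros continuous_vel continuous_curve)
  have nz: "h t \<noteq> 0" for t
    using support_line[of t] z unfolding h_def by (metis mult_zero_right less_irrefl)
  have same: "0 < h 0 * h t" for t
  proof (rule ccontr)
    assume "\<not> 0 < h 0 * h t"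
    then have "(h 0 \<le> 0 \<and> 0 \<le> h t) \<or> (0 \<le> h 0 \<and> h t \<le> 0)"
      by (auto simp: zero_less_mult_iff not_less)
    moreover have "connected (h ` UNIV)"
      by (intro connected_continuous_image cont) auto
    ultimately have "0 \<in> h ` UNIV"
      unfolding connected_iff_interval by blast
    then show False using nz by fastforce
  qed
  \<comment> \<open>Hence \<open>h 0\<close> is a positive multiple of every admissible factor
    \<open>k\<close> and can replace it.\<close>
  have *: "\<exists>c>0. h 0 = c * k" if "0 < k * h t" for k t
  proof -
    have "0 < (k * h t) * (h 0 * h t)" using that same[of t] by simp
    then have "0 < (h 0 * k) * (h t * h t)" by (simp add: mult_ac)
    then have "0 < h 0 * k" using nz[of t]
      by (metis not_real_square_gt_zero zero_less_mult_pos2)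
    then have "0 < h 0 / k" by (simp add: zero_less_divide_iff zero_less_mult_iff)
    moreover have "h 0 = h 0 / k * k" using that by (cases "k = 0") auto
    ultimately show ?thesis by blast
  qed
  show ?thesis
  proof (rule that[of "h 0"])
    fix t y
    obtain k where k: "\<And>y. y \<in> body \<Longrightarrow> 0 \<le> k * cross2 (vel t) (y - \<Gamma> t)"
      "\<And>y. y \<in> interior body \<Longrightarrow> 0 < k * cross2 (vel t) (y - \<Gamma> t)"
      using support_line[of t] by blast
    from k(2)[OF z] obtain c where c: "c > 0" "h 0 = c * k"
      using *[of k t] unfolding h_def by blast
    show "0 \<le> h 0 * cross2 (vel t) (y - \<Gamma> t)" if "y \<in> body"
      using k(1)[OF that] c by (simp add: mult.assoc)
    show "0 < h 0 * cross2 (vel t) (y - \<Gamma> t)" if "y \<in> interior body"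
      using k(2)[OF that] c by (simp add: mult.assoc)
  qed
qed

section \<open>Straight arcs\<close>

lemma constant_vel_imp_straight:
  assumes "a \<le> b" "\<And>t. t \<in> {a..b} \<Longrightarrow> vel t = T" "t \<in> {a..b}"
  shows "\<Gamma> t = \<Gamma> a + (t - a) *\<^sub>R T"
proof -
  obtain c where c: "\<And>s. s \<in> {a..b} \<Longrightarrow> \<Gamma> s - s *\<^sub>R T = c"
  proof (rule has_vector_derivative_zero_constant)
    fix s assume "s \<in> {a..b}"
    then show "((\<lambda>s. \<Gamma> s - s *\<^sub>R T) has_vector_derivative 0) (at s within {a..b})"
      using assms(2) has_vel[of s "{a..b}"]
      by (auto intro!: derivative_eq_intros simp: has_vector_derivative_def)
  qed simp_all
  have "\<Gamma> t - t *\<^sub>R T = \<Gamma> a - a *\<^sub>R T"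
    using c[of t] c[of a] assms by simp
  then show ?thesis by (simp add: algebra_simps)
qed

text \<open>
  Otherwise two points of the curve off the segment, one on each arc, would disconnect it.
\<close>

lemma arc_in_segment:
  assumes "0 < d" "d < 2 * pi" "closed_segment (\<Gamma> x) (\<Gamma> (x + d)) \<subseteq> range \<Gamma>"
  shows "\<Gamma> ` {x<..<x + d} \<subseteq> closed_segment (\<Gamma> x) (\<Gamma> (x + d)) \<or>
    \<Gamma> ` {x + d<..<x + 2 * pi} \<subseteq> closed_segment (\<Gamma> x) (\<Gamma> (x + d))"
proof (rule ccontr)
  let ?S = "closed_segment (\<Gamma> x) (\<Gamma> (x + d))"
  assume "\<not> ?thesis"
  then obtain s t where s: "x < s" "s < x + d" "\<Gamma> s \<notin> ?S"
    and t: "x + d < t" "t < x + 2 * pi" "\<Gamma> t \<notin> ?S"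
    by (auto simp: image_subset_iff)
  \<comment> \<open>The two arcs into which the points \<open>\<Gamma> s\<close> and
    \<open>\<Gamma> t\<close> cut the curve; starting the first at \<open>t - 2 * pi\<close> makes
    it run through \<open>\<Gamma> x\<close>.\<close>
  define U V where "U = \<Gamma> ` {t - 2 * pi..s}" and "V = \<Gamma> ` {s..t}"
  have t': "\<Gamma> (t - 2 * pi) = \<Gamma> t"
    using plus_period[of "t - 2 * pi"] by simp
  have "closed U" "closed V"
    unfolding U_def V_def
    by (intro compact_imp_closed compact_continuous_image continuous_curve compact_Icc)+
  moreover have "?S \<subseteq> U \<union> V"
  proof
    fix y assume "y \<in> ?S"
    then obtain r where r: "y = \<Gamma> r" using assms(3) by blast
    define n where "n = \<lfloor>(r - (t - 2 * pi)) / (2 * pi)\<rfloor>"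
    define r' where "r' = r - of_int n * (2 * pi)"
    have "of_int n \<le> (r - (t - 2 * pi)) / (2 * pi)" "(r - (t - 2 * pi)) / (2 * pi) < of_int n + 1"
      by (simp_all add: n_def floor_correct)
    then have "t - 2 * pi \<le> r'" "r' \<le> t"
      by (simp_all add: r'_def field_simps)
    moreover have "\<Gamma> r' = y" using r by (simp add: r'_def minus_of_int)
    ultimately show "y \<in> U \<union> V" unfolding U_def V_def
      by (cases "r' \<le> s") auto
  qed
  \<comment> \<open>The arcs share only their ends \<open>\<Gamma> s\<close> and
    \<open>\<Gamma> t\<close>, and these are off the segment.\<close>
  moreover have "U \<inter> V \<inter> ?S = {}"
  proof (rule ccontr)
    assume "\<not> ?thesis"
    then obtain u v where uv: "t - 2 * pi \<le> u" "u \<le> s" "s \<le> v" "v \<le> t"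
      "\<Gamma> u = \<Gamma> v" "\<Gamma> u \<in> ?S"
      unfolding U_def V_def by auto
    then have "u \<noteq> s" "v \<noteq> s" "u \<noteq> t - 2 * pi" "v \<noteq> t"
      using s t t' by auto
    then show False using curve_neq[of u v] uv by auto
  qed
  moreover have "\<Gamma> x \<in> U" "\<Gamma> (x + d) \<in> V"
    using s t unfolding U_def V_def by auto
  then have "U \<inter> ?S \<noteq> {}" "V \<inter> ?S \<noteq> {}"
    by auto
  ultimately show False
    using connected_segment(1)[of "\<Gamma> x" "\<Gamma> (x + d)"] unfolding connected_closed by blast
qed

text \<open>Both points lie on one support line, so the segment joining them avoids the interior of
  the body and belongs to the curve. By \<open>arc_in_segment\<close> one of the two arcs lies in
  it; each outcome corresponds to one arc.\<close>

lemma equal_vel_imp_straight: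
  assumes "0 < d" "d < 2 * pi" "vel (x + d) = vel x"
  obtains "\<Gamma> (x + d) = \<Gamma> x + d *\<^sub>R vel x"
  | "\<And>t. t \<in> {x + d..x + 2 * pi} \<Longrightarrow> \<Gamma> t = \<Gamma> (x + d) + (t - (x + d)) *\<^sub>R vel x"
proof -
  let ?T = "vel x" and ?S = "closed_segment (\<Gamma> x) (\<Gamma> (x + d))"
  obtain \<sigma> where \<sigma>: "\<And>t y. y \<in> body \<Longrightarrow> 0 \<le> \<sigma> * cross2 (vel t) (y - \<Gamma> t)"
    "\<And>t y. y \<in> interior body \<Longrightarrow> 0 < \<sigma> * cross2 (vel t) (y - \<Gamma> t)"
    using orientation by blast
  have \<sigma>0: "\<sigma> \<noteq> 0"
    using \<sigma>(2) body(3) by fastforce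
  \<comment> \<open>The tangents at the two points are parallel and have the body on the same side,
    so each point lies on the tangent at the other.\<close>
  have "0 \<le> \<sigma> * cross2 ?T (\<Gamma> (x + d) - \<Gamma> x)" "0 \<le> \<sigma> * cross2 ?T (\<Gamma> x - \<Gamma> (x + d))"
    using \<sigma>(1)[OF curve_in_body, of x] \<sigma>(1)[OF curve_in_body, of "x + d"] assms(3) by metis+
  then have AB: "cross2 ?T (\<Gamma> (x + d)) = cross2 ?T (\<Gamma> x)"
    using \<sigma>0 by (simp add: cross2_diff_right right_diff_distrib)
  have on_line: "cross2 ?T (y - \<Gamma> x) = 0" if "y \<in> ?S" for y
  proof -
    from that obtain u where "y = (1 - u) *\<^sub>R \<Gamma> x + u *\<^sub>R \<Gamma> (x + d)"
      by (auto simp: in_segment)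
    then have "y - \<Gamma> x = u *\<^sub>R (\<Gamma> (x + d) - \<Gamma> x)"
      by (simp add: algebra_simps)
    then have "cross2 ?T (y - \<Gamma> x) = u * (cross2 ?T (\<Gamma> (x + d)) - cross2 ?T (\<Gamma> x))"
      by (simp add: cross2_scaleR_right cross2_diff_right)
    then show ?thesis using AB by simp
  qed
  have "?S \<subseteq> range \<Gamma>"
  proof
    fix y assume y: "y \<in> ?S"
    then have "y \<in> body"
      using body(2) curve_in_body closed_segment_subset by blast
    moreover have "y \<notin> interior body"
      using \<sigma>(2)[of y x] on_line[OF y] by auto
    ultimately show "y \<in> range \<Gamma>"
      using body(4) closure_subset unfolding frontier_def by blast
  qed
  note arc = arc_in_segment[OF assms(1,2) this]
  have straight: "\<Gamma> t = \<Gamma> a + (t - a) *\<^sub>R ?T"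
    if ab: "a < b" "\<Gamma> ` {a<..<b} \<subseteq> ?S" "vel a = ?T" "t \<in> {a..b}" for a b t
  proof (rule constant_vel_imp_straight[of a b])
    have sub: "\<Gamma> ` {a..b} \<subseteq> ?S"
      using image_closure_subset[OF continuous_curve closed_segment ab(2)] ab(1) by simp
    fix s assume s: "s \<in> {a..b}"
    have par: "cross2 ?T (vel r) = 0" if "r \<in> {a..b}" for r
    proof -
      have "cross2 ?T (\<Gamma> r - \<Gamma> x) = 0"
        using on_line sub that by blast
      then have "\<sigma> * cross2 ?T (\<Gamma> r) \<le> \<sigma> * cross2 ?T (\<Gamma> q)" for q
        using \<sigma>(1)[OF curve_in_body, of x q] by (simp add: cross2_diff_right right_diff_distrib)
      \<comment> \<open>\<open>?T\<close> turned through a right angle and scaled by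
        \<open>\<sigma>\<close>, which writes \<open>\<sigma> * cross2 ?T v\<close> as an inner
        product. Points of the arc minimize this functional over the whole curve.\<close>
      moreover define c where "c = \<sigma> *\<^sub>R (\<chi> i. if i = 1 then - ?T $ 2 else ?T $ 1 :: real^2)"
      have c: "c \<bullet> v = \<sigma> * cross2 ?T v" for v
        by (simp add: c_def cross2_def inner_vec_def sum_2 algebra_simps)
      ultimately have "c \<bullet> vel r = 0"
        by (intro inner_vel_eq_0_at_min) simp
      then show ?thesis using c \<sigma>0 by simp
    qed
    have unit: "(?T \<bullet> vel r) * (?T \<bullet> vel r) = 1" if "r \<in> {a..b}" for r
      using inner_cross2_identity[of ?T "vel r" "vel r"] par[OF that] norm_vel
      by (simp add: norm_eq_1)
    \<comment> \<open>The velocity is a unit vector parallel to \<open>?T\<close>; by continuity it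
      cannot switch from \<open>?T\<close> to its negative along the arc.\<close>
    have "0 < ?T \<bullet> vel s"
    proof (rule ccontr)
      assume "\<not> 0 < ?T \<bullet> vel s"
      moreover have "?T \<bullet> vel a = 1"
        using ab(3) norm_vel[of x] by (simp add: norm_eq_1)
      moreover have "continuous_on {a..s} (\<lambda>r. ?T \<bullet> vel r)"
        by (intro continuous_intros continuous_vel)
      ultimately obtain r where "a \<le> r" "r \<le> s" "?T \<bullet> vel r = 0"
        using IVT2'[of "\<lambda>r. ?T \<bullet> vel r" s 0 a] s
        by auto
      then show False using unit[of r] s by simp
    qed
    then have "?T \<bullet> vel s = 1"
      using unit[OF s] by (simp add: square_eq_1_iff)
    then have "?T \<bullet> (vel s - ?T) = 0"
      using norm_vel[of x] by (simp add: inner_diff_right norm_eq_1)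
    moreover have "cross2 ?T (vel s - ?T) = 0"
      using par[OF s] by (simp add: cross2_diff_right) (simp add: cross2_def)
    ultimately show "vel s = ?T"
      using eq_zero_if_inner_cross2[OF vel_nonzero] by fastforce
  qed (use ab in auto)
  show thesis
    using arc
  proof
    assume "\<Gamma> ` {x<..<x + d} \<subseteq> ?S"
    then show thesis
      using straight[of x "x + d" "x + d"] assms that(1) by simp
  next
    assume "\<Gamma> ` {x + d<..<x + 2 * pi} \<subseteq> ?S"
    then show thesis
      by (intro that(2) straight[of "x + d" "x + 2 * pi"]) (use assms in auto)
  qed
qed

section \<open>Rotation number one quarter\<close>

text \<open>A chord as long as its arc has the middle point of the arc as its midpoint. Points
  spaced by \<open>pi/4\<close> would thus form an arithmetic progression, yet eight steps make a
  full period.\<close>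

lemma quarter_chord_neq:
  assumes "\<And>t. norm (\<Gamma> (t + pi/2) - \<Gamma> t) = l"
  shows "l \<noteq> pi/2"
proof
  assume l: "l = pi/2"
  define P where "P k = \<Gamma> (real k * (pi/4))" for k
  have mid: "P (Suc k) - P k = P (Suc (Suc k)) - P (Suc k)" for k
  proof (rule eq_midpoint_if_dist_le[of _ _ "pi/4"])
    show "norm (P (Suc k) - P k) \<le> pi/4" "norm (P (Suc (Suc k)) - P (Suc k)) \<le> pi/4"
      using lipschitz[of "real (Suc k) * (pi/4)" "real k * (pi/4)"]
        lipschitz[of "real (Suc (Suc k)) * (pi/4)" "real (Suc k) * (pi/4)"]
      unfolding P_def by (simp_all only: of_nat_Suc distrib_right) simp_all
    have "real (Suc (Suc k)) * (pi/4) = real k * (pi/4) + pi/2"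
      by (simp add: algebra_simps)
    then show "norm (P (Suc (Suc k)) - P k) = 2 * (pi/4)"
      using assms[of "real k * (pi/4)"] l unfolding P_def by (simp only:)
  qed
  have step: "P (Suc k) - P k = P 1 - P 0" for k
  proof (induction k)
    case (Suc k)
    then show ?case
      using mid[of k] by metis
  qed simp
  have "P k = P 0 + real k *\<^sub>R (P 1 - P 0)" for k
  proof (induction k)
    case (Suc k)
    have "P (Suc k) = P k + (P 1 - P 0)" using step[of k] by (simp add: algebra_simps)
    then show ?case using Suc by (simp add: algebra_simps)
  qed simp
  moreover have "P 8 = P 0"
    using plus_period[of 0] by (simp add: P_def)
  ultimately have "8 *\<^sub>R (P 1 - P 0) = 0"
    by (metis add_cancel_right_right of_nat_numeral)
  then have "P 1 = P 0" by simp
  then show False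
    using curve_neq[of 0 "pi/4"] by (simp add: P_def)
qed

lemma quarter_vel_neq:
  assumes "\<And>t. norm (\<Gamma> (t + pi/2) - \<Gamma> t) = l"
  shows "vel (t + pi/2) \<noteq> vel t"
proof
  assume eq: "vel (t + pi/2) = vel t"
  have "0 < pi/2" "pi/2 < 2 * pi" by simp_all
  then have "l = pi/2"
  proof (rule equal_vel_imp_straight[OF _ _ eq])
    assume "\<Gamma> (t + pi/2) = \<Gamma> t + (pi/2) *\<^sub>R vel t"
    then show ?thesis using assms[of t] norm_vel[of t] by simp
  next
    assume *: "\<And>s. s \<in> {t + pi/2..t + 2 * pi} \<Longrightarrow>
      \<Gamma> s = \<Gamma> (t + pi/2) + (s - (t + pi/2)) *\<^sub>R vel t"
    \<comment> \<open>The straight complementary arc has length \<open>3*pi/2\<close>, so it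
      contains the whole next quarter.\<close>
    have "\<Gamma> (t + pi/2 + pi/2) = \<Gamma> (t + pi/2) + (pi/2) *\<^sub>R vel t"
      using *[of "t + pi/2 + pi/2"] by simp
    then show ?thesis using assms[of "t + pi/2"] norm_vel[of t] by simp
  qed
  then show False using quarter_chord_neq[OF assms] by blast
qed

section \<open>Constant centre and radius\<close>

lemma quarter_is_circle:
  assumes chord: "\<And>t. norm (\<Gamma> (t + pi/2) - \<Gamma> t) = l"
  shows "is_circle (range \<Gamma>)"
proof -
  have rhombus: "\<Gamma> t + \<Gamma> (t + pi) = \<Gamma> (t + pi/2) + \<Gamma> (t + 3*pi/2)" for t
  proof (rule rhombus_diagonals_bisect[of _ _ l])
    have e: "t + pi/2 + pi/2 = t + pi" "t + pi + pi/2 = t + 3*pi/2"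
      "t + 3*pi/2 + pi/2 = t + 2*pi" by simp_all
    show "norm (\<Gamma> (t + pi/2) - \<Gamma> t) = l" "norm (\<Gamma> (t + pi) - \<Gamma> (t + pi/2)) = l"
      "norm (\<Gamma> (t + 3*pi/2) - \<Gamma> (t + pi)) = l" "norm (\<Gamma> t - \<Gamma> (t + 3*pi/2)) = l"
      using chord[of t] chord[of "t + pi/2"] chord[of "t + pi"] chord[of "t + 3*pi/2"]
      by (simp_all only: e plus_period)
  qed (use curve_neq[of t "t + pi"] curve_neq[of "t + pi/2" "t + 3*pi/2"] in simp_all)
  have vel_sum: "vel t + vel (t + pi) = vel (t + pi/2) + vel (t + 3*pi/2)" for t
  proof (rule vector_derivative_unique_at)
    show "((\<lambda>t. \<Gamma> t + \<Gamma> (t + pi)) has_vector_derivative vel t + vel (t + pi)) (at t)"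
      by (intro has_vector_derivative_add has_vel has_vel_shift)
    show "((\<lambda>t. \<Gamma> t + \<Gamma> (t + pi)) has_vector_derivative
        vel (t + pi/2) + vel (t + 3*pi/2)) (at t)"
      unfolding rhombus by (intro has_vector_derivative_add has_vel_shift)
  qed
  have neq1: "vel (t + pi/2) \<noteq> vel t" and neq2: "vel (t + pi) \<noteq> vel (t + pi/2)" for t
    using quarter_vel_neq[OF chord, of t] quarter_vel_neq[OF chord, of "t + pi/2"]
    by (simp_all add: add.assoc)
  have antipodal: "vel (t + pi) = - vel t" for t
  proof (rule ccontr)
    let ?s = "vel t + vel (t + pi)"
    assume "vel (t + pi) \<noteq> - vel t"
    then have "0 \<noteq> ?s" by (metis add_eq_0_iff)
    \<comment> \<open>By \<open>vel_sum\<close>, the points \<open>0\<close>, \<open>vel t\<close>,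
      \<open>?s\<close>, \<open>vel (t + pi/2)\<close> form a rhombus with unit sides; bisection of
      its diagonals would give \<open>vel (t + pi) = vel (t + pi/2)\<close>.\<close>
    moreover have "norm (vel t - 0) = 1" "norm (?s - vel t) = 1"
      "norm (vel (t + pi/2) - ?s) = 1" "norm (0 - vel (t + pi/2)) = 1"
      by (simp_all add: norm_vel) (simp add: vel_sum norm_vel)
    ultimately have "0 + ?s = vel t + vel (t + pi/2)"
      using neq1[of t] by (intro rhombus_diagonals_bisect[of _ _ 1]) auto
    then show False using neq2[of t] by simp
  qed
  obtain c where c: "\<And>t. \<Gamma> t + \<Gamma> (t + pi) = c"
  proof (rule has_vector_derivative_zero_constant)
    show "((\<lambda>t. \<Gamma> t + \<Gamma> (t + pi)) has_vector_derivative 0) (at t within UNIV)" for t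
      using has_vector_derivative_add[OF has_vel[of t UNIV] has_vel_shift[of pi t]]
      by (simp add: antipodal)
  qed simp_all
  define m where "m = (1/2) *\<^sub>R c"
  define p q where "p t = \<Gamma> t - m" and "q t = \<Gamma> (t + pi/2) - m" for t
  have pi_p: "\<Gamma> (t + pi) - m = - p t" for t
  proof -
    have "c = m + m" unfolding m_def by (simp flip: scaleR_left_distrib)
    then show ?thesis using c[of t] unfolding p_def by (simp add: algebra_simps)
  qed
  have rel: "norm (q t - p t) = l" "norm (- p t - q t) = l" for t
  proof -
    show "norm (q t - p t) = l" using chord[of t] by (simp add: p_def q_def)
    have "- p t - q t = \<Gamma> (t + pi) - \<Gamma> (t + pi/2)"
      unfolding pi_p[symmetric] q_def by simp
    then show "norm (- p t - q t) = l" using chord[of "t + pi/2"] by (simp add: add.assoc)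
  qed
  \<comment> \<open>\<open>q t\<close> is at distance \<open>l\<close> from both \<open>p t\<close>
    and its negative, hence orthogonal to \<open>p t\<close>.\<close>
  have pq: "p t \<bullet> q t = 0" and pp: "p t \<bullet> p t + q t \<bullet> q t = l^2" for t
  proof -
    have "(q t - p t) \<bullet> (q t - p t) = l^2" "(- p t - q t) \<bullet> (- p t - q t) = l^2"
      using rel[of t] by (simp_all flip: power2_norm_eq_inner)
    then show "p t \<bullet> q t = 0" "p t \<bullet> p t + q t \<bullet> q t = l^2"
      by (simp_all add: inner_diff_left inner_diff_right inner_commute)
  qed
  have dp: "(p has_vector_derivative vel t) (at t)"
    and dq: "(q has_vector_derivative vel (t + pi/2)) (at t)" for t
    using has_vector_derivative_diff[OF has_vel has_vector_derivative_const]
      has_vector_derivative_diff[OF has_vel_shift has_vector_derivative_const]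
    unfolding p_def[abs_def] q_def[abs_def] by force+
  have d1: "p t \<bullet> vel (t + pi/2) + vel t \<bullet> q t = 0" for t
    using bounded_bilinear.has_vector_derivative[OF bounded_bilinear_inner dp[of t] dq[of t]]
    unfolding pq by (metis has_vector_derivative_const vector_derivative_unique_at)
  have d2: "(p t \<bullet> vel t + vel t \<bullet> p t) + (q t \<bullet> vel (t + pi/2) + vel (t + pi/2) \<bullet> q t) = 0" for t
    using has_vector_derivative_add[OF
        bounded_bilinear.has_vector_derivative[OF bounded_bilinear_inner dp[of t] dp[of t]]
        bounded_bilinear.has_vector_derivative[OF bounded_bilinear_inner dq[of t] dq[of t]]]
    unfolding pp by (metis has_vector_derivative_const vector_derivative_unique_at)
  have eq: "p t \<bullet> p t = l^2 / 2" for t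
  proof -
    let ?a = "vel t" and ?b = "vel (t + pi/2)"
    have unit: "?a \<bullet> ?a = 1" "?b \<bullet> ?b = 1"
      using norm_vel by (simp_all add: norm_eq_1)
    have "?a + ?b \<noteq> 0"
      using neq2[of t] antipodal[of t] by (metis add_eq_0_iff)
    moreover have "?a - ?b \<noteq> 0"
      using neq1[of t] by simp
    moreover have "(?a + ?b) \<bullet> (?a - ?b) = 0"
      using unit by (simp add: inner_add_left inner_diff_right inner_commute[of ?b ?a])
    \<comment> \<open>The sum and the difference of half of \<open>d2\<close> and
      \<open>d1\<close>.\<close>
    moreover have "(?a + ?b) \<bullet> (p t + q t) = 0" "(?a - ?b) \<bullet> (p t - q t) = 0"
      using d1[of t] d2[of t]
      by (simp_all add: inner_add_left inner_add_right inner_diff_left inner_diff_right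
          inner_commute[of "p t"] inner_commute[of "q t"])
    ultimately have "(p t + q t) \<bullet> (p t - q t) = 0"
      by (rule orthogonal_if_orthogonal_to_orthogonal)
    then show ?thesis
      using pp[of t] by (simp add: inner_add_left inner_diff_right inner_commute[of "q t" "p t"])
  qed
  define r where "r = norm (p 0)"
  have "norm (p t) = r" for t
    using eq[of t] eq[of 0] unfolding r_def by (simp add: norm_eq)
  then have sub: "range \<Gamma> \<subseteq> sphere m r"
    by (auto simp: p_def dist_norm norm_minus_commute)
  have "r \<noteq> 0"
  proof
    assume "r = 0"
    then have "p 0 = 0" by (simp add: r_def)
    then have "\<Gamma> 0 = \<Gamma> (0 + pi)" using pi_p[of 0] by (simp add: p_def)
    then show False using curve_neq[of 0 pi] by simp
  qed
  then have r: "0 < r" by (simp add: r_def)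
  \<comment> \<open>As a midpoint of two curve points \<open>m\<close> is in the body, and since
    \<open>r\<close> is positive it is off the curve, hence interior.\<close>
  have "m = (1/2) *\<^sub>R \<Gamma> 0 + (1/2) *\<^sub>R \<Gamma> (0 + pi)"
    using c[of 0] unfolding m_def by (simp flip: scaleR_right_distrib)
  then have "m \<in> body"
    using convexD[OF body(2) curve_in_body curve_in_body, of "1/2" "1/2" 0 "0 + pi"] by simp
  moreover have "m \<notin> range \<Gamma>"
    using sub r by auto
  ultimately have "m \<in> interior body"
    using body(4) closure_subset unfolding frontier_def by blast
  then have "range \<Gamma> = sphere m r"
    using frontier_eq_sphere_if_subset[of body m r] body sub r compact_imp_bounded by metis
  then show ?thesis
    using r unfolding is_circle_def by blast
qed

end

theorem theorem6:
  fixes \<Gamma> :: "real \<Rightarrow> real^2" and \<rho> :: real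
  assumes "bicycle_curve \<Gamma> \<rho>"
    and "\<rho> = 1/4"
  shows "is_circle (range \<Gamma>)"
proof -
  interpret convex_curve \<Gamma>
    using assms(1) by unfold_locales (simp add: bicycle_curve_def)
  obtain l where "\<And>t. norm (\<Gamma> (t + 2 * pi * \<rho>) - \<Gamma> t) = l"
    using assms(1) unfolding bicycle_curve_def by blast
  then have "norm (\<Gamma> (t + pi/2) - \<Gamma> t) = l" for t
    using assms(2) by (metis (no_types) mult.right_neutral times_divide_eq_right
        mult_divide_mult_cancel_left_if numeral_Bit0 mult_2 zero_neq_numeral)
  then show ?thesis by (rule quarter_is_circle)
qed

end
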